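(* Let $V$ be a vertex set with $|V|=n\ge 2$ and let $G$ be the disjoint union of $n-1$ spanning arborescences $A_1,\dots,A_{n-1}$ on $V$. If there are at most two multi-roots, then $G$ has a rainbow spanning arborescence.
   Context: An arborescence is a connected digraph in which exactly one vertex (the root) has no incoming arc and every other vertex has exactly one incoming arc; it is spanning on $V$ if its vertex set is $V$. $G$ is the disjoint union of the arc sets $A_i$ (parallel arcs of different indices allowed). A subgraph $B$ of $G$ is rainbow if $|B\cap A_i|\le 1$ for all $i$. A vertex $v$ is a multi-root if $v$ is the root of at least two of the arborescences $A_1,\dots,A_{n-1}$. *)

theory Defs
  imports "Graph_Theory.Digraph_Component" "HOL-Library.Disjoint_Sets"
begin

definition is_root :: "('v, 'e) pre_digraph \<Rightarrow> 'v \<Rightarrow> bool" where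
  "is_root H r \<longleftrightarrow> r \<in> verts H \<and> in_arcs H r = {}"

text \<open>Here \<^const>\<open>connected\<close> is connectedness of the underlying undirected graph.\<close>

definition arborescence :: "('v, 'e) pre_digraph \<Rightarrow> bool" where
  "arborescence H \<longleftrightarrow> wf_digraph H \<and> connected H \<and> (\<exists>!r. is_root H r) \<and>
     (\<forall>v\<in>verts H. \<not> is_root H v \<longrightarrow> in_degree H v = 1)"

definition spanning_arborescence :: "('v, 'e) pre_digraph \<Rightarrow> ('v, 'e) pre_digraph \<Rightarrow> bool" where
  "spanning_arborescence H G \<longleftrightarrow> arborescence H \<and> spanning H G"

text \<open>
  Arcs are abstract elements of type \<open>'e\<close>, so disjointness of arc sets still permits
  parallel arcs (same tail and head) in different members of the family.
\<close>

definition disjoint_arc_union ::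
  "('v, 'e) pre_digraph \<Rightarrow> 'i set \<Rightarrow> ('i \<Rightarrow> ('v, 'e) pre_digraph) \<Rightarrow> bool" where
  "disjoint_arc_union G I A \<longleftrightarrow>
     arcs G = (\<Union>i\<in>I. arcs (A i)) \<and> disjoint_family_on (\<lambda>i. arcs (A i)) I"

definition rainbow ::
  "'i set \<Rightarrow> ('i \<Rightarrow> ('v, 'e) pre_digraph) \<Rightarrow> ('v, 'e) pre_digraph \<Rightarrow> bool" where
  "rainbow I A B \<longleftrightarrow> (\<forall>i\<in>I. finite (arcs B \<inter> arcs (A i)) \<and> card (arcs B \<inter> arcs (A i)) \<le> 1)"

definition multi_root :: "'i set \<Rightarrow> ('i \<Rightarrow> ('v, 'e) pre_digraph) \<Rightarrow> 'v \<Rightarrow> bool" where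
  "multi_root I A v \<longleftrightarrow> card {i \<in> I. is_root (A i) v} \<ge> 2"

end

theory Submission
  imports Defs
begin

text \<open>
  Everything rests on a cut property: an arborescence whose root lies in a proper vertex subset
  \<open>S\<close> has an arc leaving \<open>S\<close>.

  Any two vertices \<open>a\<close>, \<open>b\<close> lie in a common rainbow arborescence. Grow, backwards and with
  distinct colours, the set of vertices reaching \<open>a\<close> and the set of vertices reaching \<open>b\<close>. While
  these are disjoint, the root of any unused colour is outside one of them, and this colour has an
  arc entering that set. Using all \<open>n - 1\<close> colours would give sizes summing to \<open>n + 1\<close>, so at some
  point the two sets share a vertex, from which both \<open>a\<close> and \<open>b\<close> are reachable.

  A rainbow arborescence on \<open>S\<close> containing all multi-roots can always be enlarged. An unused
  colour rooted in \<open>S\<close> has an arc leaving \<open>S\<close>. If there is none, then by counting the unused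
  colours are exactly those rooted outside \<open>S\<close>. The arc of an unused colour entering the current
  root \<open>w\<close> comes from some \<open>x\<close>. If \<open>x\<close> is outside \<open>S\<close>, it becomes the new root. Otherwise replace
  the arc entering \<open>x\<close> by this one, which moves the root to \<open>x\<close> and frees a colour rooted in \<open>S\<close>.
\<close>

section \<open>Rainbow trees under an abstract cut property\<close>

text \<open>Colours stand for the arborescences, of which only the roots \<open>r\<close> and the
  property \<open>cut\<close> are kept. Applied to a complement, \<open>cut\<close> also yields arcs
  entering a nonempty set that misses the root.\<close>

locale colored_cuts =
  fixes V :: "'v set" and E :: "'e set" and tl hd :: "'e \<Rightarrow> 'v"
    and I :: "'i set" and c :: "'e \<Rightarrow> 'i" and r :: "'i \<Rightarrow> 'v"
  assumes finite_V: "finite V" and finite_I: "finite I" and card_V: "card V = Suc (card I)"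
    and ends_in_V: "e \<in> E \<Longrightarrow> tl e \<in> V \<and> hd e \<in> V"
    and root_in_V: "i \<in> I \<Longrightarrow> r i \<in> V"
    and cut: "\<lbrakk>i \<in> I; r i \<in> S; S \<subset> V\<rbrakk> \<Longrightarrow> \<exists>e\<in>E. c e = i \<and> tl e \<in> S \<and> hd e \<in> V - S"
begin

definition rainbow_set :: "'e set \<Rightarrow> bool" where
  "rainbow_set F \<longleftrightarrow> F \<subseteq> E \<and> inj_on c F \<and> c ` F \<subseteq> I"

definition ends :: "'e set \<Rightarrow> 'v rel" where
  "ends F = (\<lambda>e. (tl e, hd e)) ` F"

text \<open>A rainbow arborescence with arc set \<open>F\<close>, vertex set \<open>S\<close> and
  root \<open>w\<close>. The bijection encodes in-degree one off \<open>w\<close> and zero at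
  \<open>w\<close>, in a form that is easy to update when arcs are added or exchanged.\<close>

definition rtree :: "'e set \<Rightarrow> 'v set \<Rightarrow> 'v \<Rightarrow> bool" where
  "rtree F S w \<longleftrightarrow> w \<in> S \<and> S \<subseteq> V \<and> rainbow_set F \<and> tl ` F \<subseteq> S \<and> bij_betw hd F (S - {w}) \<and>
     (\<forall>v\<in>S. (w, v) \<in> (ends F)\<^sup>*)"

lemma ends_mono: "F \<subseteq> F' \<Longrightarrow> (ends F)\<^sup>* \<subseteq> (ends F')\<^sup>*"
  unfolding ends_def by (intro rtrancl_mono image_mono)

lemma ends_insertI: "(x, y) \<in> (ends F)\<^sup>* \<Longrightarrow> (x, y) \<in> (ends (insert e F))\<^sup>*"
  using ends_mono[of F "insert e F"] by blast

lemma ends_step: "e \<in> F \<Longrightarrow> (tl e, hd e) \<in> ends F"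
  unfolding ends_def by blast

lemma rainbow_set_subset: "rainbow_set F \<Longrightarrow> F' \<subseteq> F \<Longrightarrow> rainbow_set F'"
  unfolding rainbow_set_def by (auto intro: inj_on_subset)

lemma rainbow_set_insert: "\<lbrakk>rainbow_set F; e \<in> E; c e \<in> I; c e \<notin> c ` F\<rbrakk> \<Longrightarrow> rainbow_set (insert e F)"
  unfolding rainbow_set_def by auto

lemma finite_rainbow_set: "rainbow_set F \<Longrightarrow> finite F"
  unfolding rainbow_set_def using finite_I by (meson finite_imageD finite_subset)

lemma rtree_single: "w \<in> V \<Longrightarrow> rtree {} {w} w"
  unfolding rtree_def rainbow_set_def by (auto simp: bij_betw_def)

lemma card_rtree: assumes "rtree F S w" shows "card S = Suc (card F)"
proof -
  have "bij_betw hd F (S - {w})" "w \<in> S" "finite S"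
    using assms finite_V by (auto simp: rtree_def intro: finite_subset)
  moreover from this(1) have "card F = card (S - {w})" by (rule bij_betw_same_card)
  ultimately show ?thesis by (metis card.remove)
qed

section \<open>Adding and exchanging arcs of a rainbow tree\<close>

lemma rtree_add_leaf:
  assumes "rtree F S w" "tl e \<in> S" "hd e \<notin> S" "rainbow_set (insert e F)"
  shows "rtree (insert e F) (insert (hd e) S) w"
proof -
  have e: "e \<notin> F" "hd e \<in> V"
    using assms ends_in_V by (auto simp: rtree_def bij_betw_def rainbow_set_def)
  have "bij_betw hd (insert e F) (insert (hd e) (S - {w}))"
    using assms e by (intro iffD1[OF notIn_Un_bij_betw3[of e F hd "S - {w}", simplified]])
      (auto simp: rtree_def)
  moreover have "insert (hd e) (S - {w}) = insert (hd e) S - {w}"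
    using assms by (auto simp: rtree_def)
  moreover have "(w, v) \<in> (ends (insert e F))\<^sup>*" if "v \<in> S" for v
    using that assms(1) by (auto simp: rtree_def intro: ends_insertI)
  moreover from this have "(w, hd e) \<in> (ends (insert e F))\<^sup>*"
    using assms(2) ends_step[of e "insert e F"] by (meson insertI1 rtrancl.rtrancl_into_rtrancl)
  ultimately show ?thesis
    using assms e unfolding rtree_def by auto
qed

lemma rtree_add_root:
  assumes "rtree F S w" "hd e = w" "tl e \<notin> S" "rainbow_set (insert e F)"
  shows "rtree (insert e F) (insert (tl e) S) (tl e)"
proof -
  have e: "e \<notin> F" "tl e \<in> V" "w \<in> S"
    using assms ends_in_V by (auto simp: rtree_def bij_betw_def rainbow_set_def)
  have "bij_betw hd (insert e F) (insert (hd e) (S - {w}))"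
    using assms e by (intro iffD1[OF notIn_Un_bij_betw3[of e F hd "S - {w}", simplified]])
      (auto simp: rtree_def)
  moreover have "insert (hd e) (S - {w}) = insert (tl e) S - {tl e}"
    using assms e by auto
  moreover have "(tl e, v) \<in> (ends (insert e F))\<^sup>*" if "v \<in> S" for v
  proof (rule converse_rtrancl_into_rtrancl)
    show "(tl e, w) \<in> ends (insert e F)" using assms(2) ends_step[of e "insert e F"] by simp
    show "(w, v) \<in> (ends (insert e F))\<^sup>*" using that assms(1) by (auto simp: rtree_def intro: ends_insertI)
  qed
  ultimately show ?thesis
    using assms e unfolding rtree_def by auto
qed

text \<open>A walk through \<open>f\<close> can be cut after its last use of \<open>f\<close>; the
  remainder starts at \<open>hd f\<close>.\<close>

lemma rtrancl_avoid_arc: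
  assumes "(w, v) \<in> (ends F)\<^sup>*"
  shows "(w, v) \<in> (ends (F - {f}))\<^sup>* \<or> (hd f, v) \<in> (ends (F - {f}))\<^sup>*"
  using assms
proof induction
  case (step y z)
  then obtain g where g: "g \<in> F" "y = tl g" "z = hd g" by (auto simp: ends_def)
  show ?case
  proof (cases "g = f")
    case False
    then have "(y, z) \<in> ends (F - {f})" using g ends_step by simp
    then show ?thesis using step.IH by (meson rtrancl.rtrancl_into_rtrancl)
  qed (use g in simp)
qed simp

text \<open>Paths from \<open>w\<close> that avoid \<open>f\<close> are prolonged backwards by
  \<open>e\<close>; the others can be restarted at \<open>hd f\<close>, which is the new root. Among
  the heads \<open>w\<close> replaces \<open>tl e\<close>, so \<open>S\<close> is unchanged.\<close>

lemma rtree_reroot: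
  assumes "rtree F S w" "hd e = w" "f \<in> F" "hd f = tl e" "rainbow_set (insert e (F - {f}))"
  shows "rtree (insert e (F - {f})) S (tl e)"
proof -
  let ?F = "insert e (F - {f})"
  have bij: "bij_betw hd F (S - {w})" and wS: "w \<in> S" using assms(1) by (auto simp: rtree_def)
  have e: "e \<notin> F" using assms(2) bij by (auto simp: bij_betw_def)
  have x: "tl e \<in> S - {w}" using assms(3,4) bij by (metis bij_betw_apply)
  have "hd ` (F - {f}) = hd ` F - hd ` {f}"
    using bij assms(3) by (intro inj_on_image_set_diff[of hd F]) (auto simp: bij_betw_def)
  then have "hd ` (F - {f}) = S - {w} - {tl e}"
    using bij assms(4) by (simp add: bij_betw_def)
  then have "bij_betw hd (F - {f}) (S - {w} - {tl e})"
    by (rule bij_betw_subset[OF bij Diff_subset])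
  then have "bij_betw hd ?F (insert (hd e) (S - {w} - {tl e}))"
    using assms(2) e by (intro iffD1[OF notIn_Un_bij_betw3[of e "F - {f}" hd "S - {w} - {tl e}",
      simplified]]) auto
  moreover have "insert (hd e) (S - {w} - {tl e}) = S - {tl e}"
    using assms(2) wS x by auto
  moreover have "(tl e, v) \<in> (ends ?F)\<^sup>*" if "v \<in> S" for v
  proof -
    have "(w, v) \<in> (ends (F - {f}))\<^sup>* \<or> (tl e, v) \<in> (ends (F - {f}))\<^sup>*"
      using rtrancl_avoid_arc that assms(1,4) unfolding rtree_def by metis
    then have "(w, v) \<in> (ends ?F)\<^sup>* \<or> (tl e, v) \<in> (ends ?F)\<^sup>*"
      using ends_mono[of "F - {f}" ?F] by blast
    then show ?thesis
      using ends_step[of e ?F] assms(2) by (auto intro: converse_rtrancl_into_rtrancl)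
  qed
  ultimately show ?thesis
    using assms x unfolding rtree_def by auto
qed

text \<open>Arcs of the path whose head is already in the tree are skipped, which keeps heads
  distinct. Colours cannot clash, since all arcs come from the rainbow set \<open>D\<close>.\<close>

lemma rtree_add_path:
  assumes "rainbow_set D" "(x, y) \<in> (ends D)\<^sup>*" "rtree F S w" "F \<subseteq> D" "x \<in> S"
  obtains F' S' where "rtree F' S' w" "F' \<subseteq> D" "S \<subseteq> S'" "y \<in> S'"
proof -
  from assms(2) have "\<exists>F' S'. rtree F' S' w \<and> F' \<subseteq> D \<and> S \<subseteq> S' \<and> y \<in> S'"
  proof induction
    case base
    then show ?case using assms by blast
  next
    case (step y z)
    then obtain F' S' where IH: "rtree F' S' w" "F' \<subseteq> D" "S \<subseteq> S'" "y \<in> S'" by blast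
    obtain e where e: "e \<in> D" "tl e = y" "hd e = z" using step(2) by (auto simp: ends_def)
    show ?case
    proof (cases "z \<in> S'")
      case True
      then show ?thesis using IH by blast
    next
      case False
      have "rtree (insert e F') (insert z S') w"
        using rtree_add_leaf[OF IH(1), of e] IH(2,4) e False rainbow_set_subset[OF assms(1)] by auto
      then show ?thesis using IH e by blast
    qed
  qed
  then show ?thesis using that by blast
qed

section \<open>A rainbow tree through two given vertices\<close>

text \<open>The size equation is conditional so that the induction can run up to
  \<open>m = card I\<close> even after \<open>X\<close> and \<open>Y\<close> have met.\<close>

lemma backward_growth:
  assumes "a \<in> V" "b \<in> V" "m \<le> card I"
  shows "\<exists>D X Y. rainbow_set D \<and> card D = m \<and> X \<subseteq> V \<and> Y \<subseteq> V \<and> a \<in> X \<and> b \<in> Y \<and>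
    (\<forall>v\<in>X. (v, a) \<in> (ends D)\<^sup>*) \<and> (\<forall>v\<in>Y. (v, b) \<in> (ends D)\<^sup>*) \<and>
    (X \<inter> Y = {} \<longrightarrow> card X + card Y = m + 2)"
  using assms(3)
proof (induction m)
  case 0
  have "rainbow_set {}" by (simp add: rainbow_set_def)
  moreover have "{a} \<inter> {b} = {} \<longrightarrow> card {a} + card {b} = 0 + 2" by simp
  ultimately show ?case
    using assms(1,2) by (intro exI[of _ "{}"] exI[of _ "{a}"] exI[of _ "{b}"]) simp
next
  case (Suc m)
  from Suc.IH[OF Suc_leD[OF Suc.prems]]
  obtain D X Y where D: "rainbow_set D" "card D = m" and XY: "X \<subseteq> V" "Y \<subseteq> V" "a \<in> X" "b \<in> Y"
    and reach: "\<forall>v\<in>X. (v, a) \<in> (ends D)\<^sup>*" "\<forall>v\<in>Y. (v, b) \<in> (ends D)\<^sup>*"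
    and size: "X \<inter> Y = {} \<longrightarrow> card X + card Y = m + 2"
    by (elim exE conjE)
  have fin: "finite X" "finite Y" using XY finite_V by (auto intro: finite_subset)
  have "card (c ` D) = m" using D by (simp add: rainbow_set_def card_image)
  then have "c ` D \<noteq> I" using Suc.prems by auto
  then obtain i where i: "i \<in> I" "i \<notin> c ` D" using D(1) by (auto simp: rainbow_set_def)
  \<comment> \<open>An arc leaving \<open>V - Z\<close>, which contains \<open>r i\<close>, enters
    \<open>Z\<close>.\<close>
  have entering: "\<exists>e. c e = i \<and> tl e \<in> V - Z \<and> hd e \<in> Z \<and> rainbow_set (insert e D)"
    if "Z \<subseteq> V" "Z \<noteq> {}" "r i \<notin> Z" for Z
  proof -
    have "r i \<in> V - Z" "V - Z \<subset> V" using that root_in_V[OF i(1)] by auto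
    from cut[OF i(1) this]
    obtain e where e: "e \<in> E" "c e = i" "tl e \<in> V - Z" "hd e \<in> V - (V - Z)" by (elim bexE conjE)
    moreover have "rainbow_set (insert e D)" using e(1,2) i D(1) by (intro rainbow_set_insert) auto
    ultimately show ?thesis by auto
  qed
  have extend: "\<forall>v\<in>Z. (v, z) \<in> (ends (insert e D))\<^sup>*" if "\<forall>v\<in>Z. (v, z) \<in> (ends D)\<^sup>*" for Z z e
    using that ends_insertI by simp
  have extend_insert: "\<forall>v\<in>insert (tl e) Z. (v, z) \<in> (ends (insert e D))\<^sup>*"
    if "\<forall>v\<in>Z. (v, z) \<in> (ends D)\<^sup>*" "hd e \<in> Z" for Z z e
  proof -
    have old: "\<forall>v\<in>Z. (v, z) \<in> (ends (insert e D))\<^sup>*" by (rule extend[OF that(1)])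
    have "(tl e, hd e) \<in> ends (insert e D)" by (rule ends_step) simp
    then have "(tl e, z) \<in> (ends (insert e D))\<^sup>*"
      using bspec[OF old that(2)] by (rule converse_rtrancl_into_rtrancl)
    then show ?thesis using old by simp
  qed
  have card_insert: "card (insert e D) = Suc m" if "c e = i" for e
    using D finite_rainbow_set that i by (subst card_insert_disjoint) auto
  show ?case
  proof (cases "r i \<in> X")
    case False
    then obtain e where e: "c e = i" "tl e \<in> V - X" "hd e \<in> X" "rainbow_set (insert e D)"
      using entering[of X] XY by blast
    have "insert (tl e) X \<inter> Y = {} \<longrightarrow> card (insert (tl e) X) + card Y = Suc m + 2"
      using size e(2) fin by simp
    moreover have "insert (tl e) X \<subseteq> V" using XY(1) e(2) by simp
    ultimately show ?thesis
      by (intro exI[of _ "insert e D"] exI[of _ "insert (tl e) X"] exI[of _ Y] conjI e(4)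
        card_insert[OF e(1)] insertI2[OF XY(3)] XY(2,4) extend_insert[OF reach(1) e(3)]
        extend[OF reach(2)])
  next
    case inX: True
    show ?thesis
    proof (cases "r i \<in> Y")
      case False
      then obtain e where e: "c e = i" "tl e \<in> V - Y" "hd e \<in> Y" "rainbow_set (insert e D)"
        using entering[of Y] XY by blast
      have "X \<inter> insert (tl e) Y = {} \<longrightarrow> card X + card (insert (tl e) Y) = Suc m + 2"
        using size e(2) fin by simp
      moreover have "insert (tl e) Y \<subseteq> V" using XY(2) e(2) by simp
      ultimately show ?thesis
        by (intro exI[of _ "insert e D"] exI[of _ X] exI[of _ "insert (tl e) Y"] conjI e(4)
          card_insert[OF e(1)] insertI2[OF XY(4)] XY(1,3) extend_insert[OF reach(2) e(3)]
          extend[OF reach(1)])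
    next
      case True
      \<comment> \<open>Here \<open>X\<close> and \<open>Y\<close> share \<open>r i\<close>, so
        nothing needs to grow; any arc of colour \<open>i\<close> serves to raise
        \<open>card D\<close>.\<close>
      obtain e where e: "e \<in> E" "c e = i"
      proof (cases "V = {r i}")
        case True
        then have "card I = 0" using card_V by simp
        then show ?thesis using finite_I i(1) by simp
      next
        case False
        then show ?thesis using that cut[OF i(1), of "{r i}"] root_in_V[OF i(1)] by blast
      qed
      then have "rainbow_set (insert e D)" using i D(1) rainbow_set_insert by blast
      moreover have "X \<inter> Y = {} \<longrightarrow> card X + card Y = Suc m + 2" using inX True by blast
      ultimately show ?thesis
        by (intro exI[of _ "insert e D"] exI[of _ X] exI[of _ Y] conjI card_insert[OF e(2)] XY
          extend[OF reach(1)] extend[OF reach(2)])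
    qed
  qed
qed

text \<open>With all colours used, disjoint \<open>X\<close> and \<open>Y\<close> would have more
  vertices together than \<open>V\<close>. From a common vertex, the paths to \<open>a\<close> and
  \<open>b\<close> lie in the same rainbow set \<open>D\<close> and are absorbed one after the
  other.\<close>

lemma rtree_through_two:
  assumes "a \<in> V" "b \<in> V"
  obtains F S w where "rtree F S w" "a \<in> S" "b \<in> S"
proof -
  obtain D X Y where D: "rainbow_set D" "X \<subseteq> V" "Y \<subseteq> V" "\<forall>v\<in>X. (v, a) \<in> (ends D)\<^sup>*"
    "\<forall>v\<in>Y. (v, b) \<in> (ends D)\<^sup>*" and size: "X \<inter> Y = {} \<longrightarrow> card X + card Y = card I + 2"
    using backward_growth[OF assms order_refl] by blast
  have "X \<inter> Y \<noteq> {}"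
  proof
    assume "X \<inter> Y = {}"
    then have "card (X \<union> Y) = card I + 2"
      using size D finite_V by (subst card_Un_disjoint) (auto intro: finite_subset)
    moreover have "card (X \<union> Y) \<le> card V" using D finite_V by (intro card_mono) auto
    ultimately show False using card_V by simp
  qed
  then obtain w where w: "w \<in> X" "w \<in> Y" by blast
  then have reach: "(w, a) \<in> (ends D)\<^sup>*" "(w, b) \<in> (ends D)\<^sup>*" using D by auto
  have "rtree {} {w} w" using w D by (intro rtree_single) auto
  from rtree_add_path[OF D(1) reach(1) this empty_subsetI singletonI]
  obtain F S where F: "rtree F S w" "F \<subseteq> D" "{w} \<subseteq> S" "a \<in> S" .
  then have "w \<in> S" by simp
  from rtree_add_path[OF D(1) reach(2) F(1,2) this]
  obtain F' S' where "rtree F' S' w" "F' \<subseteq> D" "S \<subseteq> S'" "b \<in> S'" .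
  then show ?thesis using that F(4) by blast
qed

section \<open>Enlarging a rainbow tree to a spanning one\<close>

lemma rtree_grow:
  assumes T: "rtree F S w" and "S \<noteq> V"
    and simple: "\<forall>v\<in>V - S. card {i \<in> I. r i = v} \<le> 1"
  shows "\<exists>F' S' w'. rtree F' S' w' \<and> S \<subset> S'"
proof -
  have SV: "S \<subset> V" and wS: "w \<in> S" and rainbow_set: "rainbow_set F" using assms by (auto simp: rtree_def)
  \<comment> \<open>Stated for any tree on \<open>S\<close>, because it is applied both to
    \<open>F\<close> and to the rerooted tree.\<close>
  have leave: "\<exists>F' S' w'. rtree F' S' w' \<and> S \<subset> S'"
    if T': "rtree F' S w'" and i: "i \<in> I" "i \<notin> c ` F'" "r i \<in> S" for F' w' i
  proof -
    obtain e where e: "e \<in> E" "c e = i" "tl e \<in> S" "hd e \<in> V - S"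
      using cut[OF i(1,3) SV] by blast
    then have "rainbow_set (insert e F')" using i T' rainbow_set_insert by (auto simp: rtree_def)
    then have "rtree (insert e F') (insert (hd e) S) w'" using rtree_add_leaf[OF T'] e by auto
    then show ?thesis using e by blast
  qed
  show ?thesis
  proof (cases "\<exists>i\<in>I. i \<notin> c ` F \<and> r i \<in> S")
    case True
    then show ?thesis using leave[OF T] by blast
  next
    case False
    let ?O = "{i \<in> I. r i \<in> V - S}"
    have fin: "finite S" using SV finite_V finite_subset by blast
    have "inj_on r ?O"
    proof (rule inj_onI)
      fix i j assume ij: "i \<in> ?O" "j \<in> ?O" "r i = r j"
      then have "card {k \<in> I. r k = r i} \<le> 1" using simple by blast
      then show "i = j" using ij finite_I by (auto simp: card_le_Suc0_iff_eq)
    qed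
    then have "card ?O \<le> card (V - S)" using finite_V by (intro card_inj_on_le[of r]) auto
    also have "\<dots> = card V - card S" using SV fin by (intro card_Diff_subset) auto
    also have "\<dots> = card I - card (c ` F)"
      using card_V card_rtree[OF T] rainbow_set by (simp add: rainbow_set_def card_image)
    also have "\<dots> = card (I - c ` F)"
      using rainbow_set finite_rainbow_set by (intro card_Diff_subset[symmetric]) (auto simp: rainbow_set_def)
    finally have "card ?O \<le> card (I - c ` F)" .
    moreover have "I - c ` F \<subseteq> ?O" using False root_in_V by auto
    ultimately have unused: "I - c ` F = ?O" using finite_I by (intro card_seteq) auto
    have "card F < card I"
      using psubset_card_mono[OF finite_V SV] card_V card_rtree[OF T] by simp
    then have "c ` F \<noteq> I" using rainbow_set by (auto simp: rainbow_set_def card_image)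
    then obtain k where k: "k \<in> I" "k \<notin> c ` F" using rainbow_set by (auto simp: rainbow_set_def)
    \<comment> \<open>Since \<open>r k\<close> lies outside \<open>S\<close>, it differs from
      \<open>w\<close>; an arc leaving \<open>V - {w}\<close> must enter \<open>w\<close>.\<close>
    then have "r k \<in> V - {w}" "V - {w} \<subset> V" using unused wS SV by auto
    from cut[OF k(1) this] obtain e where e: "e \<in> E" "c e = k" "tl e \<in> V - {w}" "hd e = w"
      by auto
    show ?thesis
    proof (cases "tl e \<in> S")
      case False
      then have "rtree (insert e F) (insert (tl e) S) (tl e)"
        using rtree_add_root[OF T] e k rainbow_set rainbow_set_insert by auto
      then show ?thesis using False by blast
    next
      case True
      then have "tl e \<in> hd ` F" using T e by (auto simp: rtree_def bij_betw_def)
      then obtain f where f: "f \<in> F" "hd f = tl e" by auto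
      have "rainbow_set (insert e (F - {f}))"
        using e k by (intro rainbow_set_insert rainbow_set_subset[OF rainbow_set]) auto
      then have T': "rtree (insert e (F - {f})) S (tl e)"
        using rtree_reroot[OF T] e f by blast
      have cf: "c f \<in> I" using f(1) rainbow_set by (auto simp: rainbow_set_def)
      have "c f \<notin> I - c ` F" using f(1) by blast
      then have "r (c f) \<in> S" using cf root_in_V[OF cf] unfolding unused by simp
      moreover have "c f \<noteq> c e" using imageI[OF f(1), of c] e(2) k(2) by metis
      then have "c f \<notin> c ` insert e (F - {f})" using f(1) rainbow_set by (auto simp: rainbow_set_def inj_on_def)
      ultimately show ?thesis using leave[OF T' cf] by blast
    qed
  qed
qed

text \<open>The condition on vertices outside \<open>S\<close> is inherited by larger sets, so
  \<open>rtree_grow\<close> can be iterated.\<close>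

lemma spanning_rtree:
  assumes "rtree F S w" "\<forall>v\<in>V - S. card {i \<in> I. r i = v} \<le> 1"
  obtains F' w' where "rtree F' V w'"
proof -
  have "\<exists>F' w'. rtree F' V w'"
    using assms
  proof (induction "card V - card S" arbitrary: F S w rule: less_induct)
    case less
    show ?case
    proof (cases "S = V")
      case False
      then obtain F' S' w' where T': "rtree F' S' w'" "S \<subset> S'"
        using rtree_grow less.prems by blast
      then have "S' \<subseteq> V" by (simp add: rtree_def)
      then have "card S < card S'" "card S' \<le> card V"
        using T'(2) finite_V by (auto intro: psubset_card_mono card_mono finite_subset)
      then show ?thesis using less.hyps[OF _ T'(1)] less.prems(2) T'(2) by fastforce
    qed (use less.prems in blast)
  qed
  then show ?thesis using that by blast
qed

end

section \<open>The cut property of arborescences\<close>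

text \<open>If no arc left \<open>S\<close>, everything reachable from \<open>x\<close> would stay
  in \<open>S\<close>; but connectedness and the in-degrees make every vertex reachable from
  \<open>x\<close>.\<close>

lemma arborescence_cut:
  assumes H: "arborescence H" and root: "is_root H x" "x \<in> S" and "S \<subset> verts H"
  shows "\<exists>e\<in>arcs H. tail H e \<in> S \<and> head H e \<in> verts H - S"
proof (rule ccontr)
  assume closed: "\<not> ?thesis"
  interpret wf_digraph H using H by (simp add: arborescence_def)
  have RS: "v \<in> S" if "x \<rightarrow>\<^sup>*\<^bsub>H\<^esub> v" for v
    using that
  proof (induction rule: reachable_induct)
    case (step y z)
    then show ?case using closed by (auto simp: arcs_ends_conv)
  qed (use root in simp)
  have x: "x \<in> verts H" using root by (simp add: is_root_def)
  \<comment> \<open>The last arc of a path to \<open>head H e\<close> is the only arc entering that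
    vertex, hence equals \<open>e\<close>.\<close>
  have tail_in_R: "x \<rightarrow>\<^sup>*\<^bsub>H\<^esub> tail H e" if "e \<in> arcs H" "x \<rightarrow>\<^sup>*\<^bsub>H\<^esub> head H e" for e
  proof -
    have "\<not> is_root H (head H e)" using that by (auto simp: is_root_def in_arcs_def)
    then have indeg: "card (in_arcs H (head H e)) = 1" and "head H e \<noteq> x"
      using H that root by (auto simp: arborescence_def in_degree_def)
    from that(2) this(2) obtain y where y: "x \<rightarrow>\<^sup>*\<^bsub>H\<^esub> y" "y \<rightarrow>\<^bsub>H\<^esub> head H e"
      unfolding reachable_def by (auto elim: rtrancl_on.cases)
    from y(2) obtain f where f: "f \<in> arcs H" "tail H f = y" "head H f = head H e"
      by (auto simp: arcs_ends_conv)
    then have "e \<in> in_arcs H (head H e)" "f \<in> in_arcs H (head H e)"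
      using that(1) by (simp_all add: in_arcs_def)
    then have "e = f" using indeg by (metis card_1_singletonE singletonD)
    then show ?thesis using f(2) y(1) by simp
  qed
  have "x \<rightarrow>\<^sup>*\<^bsub>H\<^esub> v" if "v \<in> verts H" for v
  proof -
    have "x \<rightarrow>\<^sup>*\<^bsub>mk_symmetric H\<^esub> v"
      using H x that by (simp add: arborescence_def connected_def strongly_connected_def)
    \<comment> \<open>Along an undirected walk, forward arcs preserve reachability trivially and
      backward arcs by \<open>tail_in_R\<close>.\<close>
    then show ?thesis
      unfolding reachable_def[of "with_proj (mk_symmetric H)"]
    proof (induction rule: rtrancl_on_induct)
      case (step y z)
      then obtain e where e: "e \<in> arcs H"
        "y = tail H e \<and> z = head H e \<or> y = head H e \<and> z = tail H e"
        by (auto simp: parcs_mk_symmetric)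
      then have "tail H e \<rightarrow>\<^bsub>H\<^esub> head H e" by (auto simp: arcs_ends_conv)
      then show ?case using e step tail_in_R reachable_adj_trans by blast
    qed (use x in simp)
  qed
  then show False using RS assms(4) by blast
qed

section \<open>From coloured cuts back to arborescences\<close>

theorem theorem3p5:
  fixes G :: "('v, 'e) pre_digraph"
    and A :: "nat \<Rightarrow> ('v, 'e) pre_digraph"
    and n :: nat
  assumes "finite (verts G)" and "card (verts G) = n" and "n \<ge> 2"
    and "\<And>i. i \<in> {1..n-1} \<Longrightarrow> spanning_arborescence (A i) G"
    and "disjoint_arc_union G {1..n-1} A"
    and "card {v \<in> verts G. multi_root {1..n-1} A v} \<le> 2"
  shows "\<exists>B. spanning_arborescence B G \<and> rainbow {1..n-1} A B"
proof -
  let ?I = "{1..n-1}"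
  have arb: "arborescence (A i)" "verts (A i) = verts G" "arcs (A i) \<subseteq> arcs G"
    "tail (A i) = tail G" "head (A i) = head G" "wf_digraph G" if "i \<in> ?I" for i
    using assms(4)[OF that]
    by (auto simp: spanning_arborescence_def spanning_def subgraph_def compatible_def)
  interpret wf_digraph G using arb(6)[of 1] assms(3) by auto
  define c where "c e = (THE i. i \<in> ?I \<and> e \<in> arcs (A i))" for e
  define r where "r i = (THE v. is_root (A i) v)" for i
  have c: "c e = i" if "i \<in> ?I" "e \<in> arcs (A i)" for e i
    unfolding c_def
  proof (rule the_equality)
    fix j assume "j \<in> ?I \<and> e \<in> arcs (A j)"
    then show "j = i"
      using assms(5) that unfolding disjoint_arc_union_def disjoint_family_on_def by blast
  qed (use that in simp)
  have r: "is_root (A i) v \<longleftrightarrow> r i = v" if "i \<in> ?I" for i v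
    using arb(1)[OF that] theI'[of "is_root (A i)"] unfolding arborescence_def r_def by blast
  interpret colored_cuts "verts G" "arcs G" "tail G" "head G" ?I c r
  proof
    show "card (verts G) = Suc (card ?I)" using assms(2,3) by simp
    show "r i \<in> verts G" if "i \<in> ?I" for i using r[OF that] arb(2)[OF that] by (auto simp: is_root_def)
    show "\<exists>e\<in>arcs G. c e = i \<and> tail G e \<in> S \<and> head G e \<in> verts G - S"
      if i: "i \<in> ?I" and S: "r i \<in> S" "S \<subset> verts G" for i S
      using arborescence_cut[OF arb(1)[OF i], of "r i" S] arb(2-5)[OF i] S r[OF i] c[OF i] by auto
  qed (use assms(1) in auto)
  let ?M = "{v \<in> verts G. multi_root ?I A v}"
  \<comment> \<open>The set of multi-roots is padded to exactly two vertices, which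
    \<open>n \<ge> 2\<close> permits, so that \<open>rtree_through_two\<close> covers all cases at
    once.\<close>
  obtain M where M: "?M \<subseteq> M" "M \<subseteq> verts G" "card M = 2"
    using exists_subset_between[of ?M 2 "verts G"] assms(1-3,6) by auto
  then obtain a b where ab: "M = {a, b}" by (auto simp: card_2_iff)
  then obtain F S w where T: "rtree F S w" "a \<in> S" "b \<in> S"
    using rtree_through_two[of a b] M by auto
  \<comment> \<open>All multi-roots lie in \<open>M\<close>, hence in \<open>S\<close>.\<close>
  have "card {i \<in> ?I. r i = v} \<le> 1" if "v \<in> verts G - S" for v
  proof -
    have "\<not> multi_root ?I A v" using that M(1) ab T by auto
    moreover have "{i \<in> ?I. is_root (A i) v} = {i \<in> ?I. r i = v}" using r by auto
    ultimately show ?thesis by (simp add: multi_root_def)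
  qed
  then obtain F w where F: "rtree F (verts G) w" using spanning_rtree T(1) by blast
  define B where "B = \<lparr>verts = verts G, arcs = F, tail = tail G, head = head G\<rparr>"
  have F': "F \<subseteq> arcs G" "inj_on c F" "w \<in> verts G" "bij_betw (head G) F (verts G - {w})"
    "\<And>v. v \<in> verts G \<Longrightarrow> (w, v) \<in> (ends F)\<^sup>*"
    using F unfolding rtree_def rainbow_set_def by auto
  interpret B: wf_digraph B using F'(1) by unfold_locales (auto simp: B_def)
  have verts_B: "verts B = verts G" by (simp add: B_def)
  have in_w: "in_arcs B w = {}" using F'(4) by (auto simp: B_def in_arcs_def bij_betw_def)
  have in_v: "card (in_arcs B v) = 1" if "v \<in> verts G" "v \<noteq> w" for v
  proof -
    have "v \<in> head G ` F" using F'(4) that by (simp add: bij_betw_def)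
    then obtain e where e: "e \<in> F" "head G e = v" by blast
    then have "in_arcs B v = {e}" using F'(4) by (auto simp: B_def in_arcs_def bij_betw_def inj_on_def)
    then show ?thesis by simp
  qed
  have "w \<rightarrow>\<^sup>*\<^bsub>B\<^esub> v" if "v \<in> verts G" for v
    using F'(5)[OF that]
  proof induction
    case base
    show ?case using F'(3) by (intro B.reachable_refl) (simp add: B_def)
  next
    case (step y z)
    then have "y \<rightarrow>\<^bsub>B\<^esub> z" by (auto simp: ends_def arcs_ends_conv B_def)
    then show ?case using step.IH B.reachable_adj_trans by blast
  qed
  then have sym: "w \<rightarrow>\<^sup>*\<^bsub>mk_symmetric B\<^esub> v" if "v \<in> verts G" for v
    using that B.reachable_mk_symmetricI by blast
  interpret S: pair_wf_digraph "mk_symmetric B" by (rule B.wellformed_mk_symmetric)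
  \<comment> \<open>Any two vertices are joined through \<open>w\<close> once arcs may be traversed
    backwards.\<close>
  have "connected B"
    unfolding connected_def strongly_connected_def
  proof (intro conjI ballI)
    fix u v assume "u \<in> verts (with_proj (mk_symmetric B))" "v \<in> verts (with_proj (mk_symmetric B))"
    then have uv: "u \<in> verts G" "v \<in> verts G" by (auto simp: B_def)
    have "u \<rightarrow>\<^sup>*\<^bsub>mk_symmetric B\<^esub> w"
      using symmetric_reachable[OF symmetric_mk_symmetric sym[OF uv(1)]] .
    then show "u \<rightarrow>\<^sup>*\<^bsub>mk_symmetric B\<^esub> v" using sym[OF uv(2)] S.reachable_trans by blast
  qed (use F'(3) in \<open>auto simp: B_def\<close>)
  moreover have root: "is_root B v \<longleftrightarrow> v = w" for v
    using in_w in_v[of v] F'(3) verts_B by (cases "v = w") (auto simp: is_root_def)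
  ultimately have "arborescence B"
    using in_v B.wf_digraph verts_B by (auto simp: arborescence_def in_degree_def)
  moreover have "spanning B G"
    using F'(1) B.wf_digraph wf_digraph by (auto simp: spanning_def subgraph_def compatible_def B_def)
  moreover have "rainbow ?I A B"
    unfolding rainbow_def
  proof
    fix i assume i: "i \<in> ?I"
    \<comment> \<open>Both arcs have colour \<open>i\<close>, and \<open>c\<close> is injective on
      \<open>F\<close>.\<close>
    have "e = f" if "e \<in> F \<inter> arcs (A i)" "f \<in> F \<inter> arcs (A i)" for e f
      using that c[OF i] F'(2) by (auto simp: inj_on_def)
    moreover have "finite F" using F finite_rainbow_set unfolding rtree_def by blast
    ultimately show "finite (arcs B \<inter> arcs (A i)) \<and> card (arcs B \<inter> arcs (A i)) \<le> 1"
      by (auto simp: B_def card_le_Suc0_iff_eq)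
  qed
  ultimately show ?thesis unfolding spanning_arborescence_def by blast
qed

end
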